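(* For a positive integer $n$, let $\psi(n)$ denote the number of almost full cinema mappings with $n$ seats. Then $\psi(1)=1$ and, for every positive integer $n$, $\psi(n)=1+\sum_{d\mid n,\,d\neq n}\psi(d)$.
   Context: For an integer $n\ge 0$, $[n]=\{1,\dots,n\}$ (with $[0]=\emptyset$). Cinema problem: a cinema has seats $1,\dots,n$ and people with tickets $1,\dots,n$ enter in this order; person $i$ may choose any unoccupied seat whose number is a multiple of $i$, and leaves only if all those seats are already occupied by previous people. Formally, a cinema mapping with $n$ seats is an injective map $\sigma:D_\sigma\to R_\sigma$, where $D_\sigma\subseteq[n]$ and $R_\sigma=\sigma(D_\sigma)\subseteq[n]$, such that: (divisor-first) if $i\mid j$ and $j\in D_\sigma$ then $i\in D_\sigma$; (seat-multiple-ticket) $i\mid\sigma(i)$ for each $i\in D_\sigma$; and (exit rule) if $i\in[n]\setminus D_\sigma$ then every multiple of $i$ in $[n]$ equals $\sigma(j)$ for some $j\in D_\sigma$ with $j<i$. A cinema mapping $\sigma$ with $n$ seats is called almost full if $D_\sigma\supseteq[n-1]$. *)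

theory Defs
  imports Main
begin

text \<open>A cinema mapping is a partial function from tickets to seats; the tickets and the seats are
  both numbered from 1 to n.\<close>

definition cinema_mapping :: "nat \<Rightarrow> (nat \<rightharpoonup> nat) \<Rightarrow> bool" where
  "cinema_mapping n \<sigma> \<longleftrightarrow>
     dom \<sigma> \<subseteq> {1..n} \<and> ran \<sigma> \<subseteq> {1..n} \<and> inj_on \<sigma> (dom \<sigma>) \<and>
     (\<forall>i j. i dvd j \<longrightarrow> j \<in> dom \<sigma> \<longrightarrow> i \<in> dom \<sigma>) \<and>
     (\<forall>i \<in> dom \<sigma>. i dvd the (\<sigma> i)) \<and>
     (\<forall>i \<in> {1..n} - dom \<sigma>. \<forall>m \<in> {1..n}. i dvd m \<longrightarrow> (\<exists>j < i. \<sigma> j = Some m))"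

definition almost_full :: "nat \<Rightarrow> (nat \<rightharpoonup> nat) \<Rightarrow> bool" where
  "almost_full n \<sigma> \<longleftrightarrow> cinema_mapping n \<sigma> \<and> {1..n - 1} \<subseteq> dom \<sigma>"

definition psi :: "nat \<Rightarrow> nat" where
  "psi n = card {\<sigma>. almost_full n \<sigma>}"

end

theory Submission
  imports Defs
begin

text \<open>
  Everything rests on one observation: a ticket holder never sits below the ticket's number, so
  an injective seating of the tickets \<open>a, \<dots>, b\<close> within the seats up to \<open>b\<close> must be the identity
  (lemma \<open>inj_increasing_eq_id\<close>: look at \<open>b\<close>, then \<open>b - 1\<close>, and so on).

  Call a map \<open>nearly full\<close> if it seats exactly the tickets below \<open>n\<close>, injectively, each on a
  multiple of itself, in the seats \<open>1, \<dots>, n\<close>. By the observation, such a map either is the identity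
  or occupies seat \<open>n\<close>. An almost full cinema mapping seats ticket \<open>n\<close> as well, and is then the
  identity, or it is nearly full, and the exit rule for ticket \<open>n\<close> says precisely that seat \<open>n\<close> is
  occupied. So both families consist of one identity and the nearly full maps that occupy
  seat \<open>n\<close>, and \<open>psi n\<close> counts the nearly full maps.

  A nearly full map that occupies seat \<open>n\<close> does so by a ticket \<open>d\<close> which is a proper divisor of
  \<open>n\<close>. The tickets between \<open>d\<close> and \<open>n\<close> can then use only seats below \<open>n\<close>, hence they sit at their
  own numbers by the observation, and this leaves the seats \<open>1, \<dots>, d\<close> to the tickets below \<open>d\<close>: they
  form an arbitrary nearly full map for \<open>d\<close>. Hence the maps that occupy seat \<open>n\<close> are counted by the
  sum of \<open>psi d\<close> over the proper divisors \<open>d\<close> of \<open>n\<close>, and the identity contributes the summand 1.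
\<close>

section \<open>Injective maps that never decrease a number\<close>

lemma inj_increasing_eq_id:
  fixes \<tau> :: "nat \<rightharpoonup> nat"
  assumes inj: "inj_on \<tau> {a..b}"
    and incr: "\<And>i. i \<in> {a..b} \<Longrightarrow> \<exists>k. \<tau> i = Some k \<and> i \<le> k \<and> k \<le> b"
    and "i \<in> {a..b}"
  shows "\<tau> i = Some i"
  using \<open>i \<in> {a..b}\<close>
proof (induction "b - i" arbitrary: i rule: less_induct)
  case less
  obtain k where k: "\<tau> i = Some k" "i \<le> k" "k \<le> b"
    using incr less.prems by blast
  show ?case
  proof (cases "k = i")
    case True
    then show ?thesis using k by simp
  next
    case False
    then have "\<tau> k = \<tau> i"
      using less.hyps[of k] less.prems k by simp
    then have "k = i"
      using inj_onD[OF inj] k less.prems by simp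
    then show ?thesis using False by simp
  qed
qed

section \<open>Nearly full maps\<close>

definition nearly_full :: "nat \<Rightarrow> (nat \<rightharpoonup> nat) set" where
  "nearly_full n = {\<tau>. dom \<tau> = {1..<n} \<and> ran \<tau> \<subseteq> {1..n} \<and> inj_on \<tau> {1..<n} \<and>
     (\<forall>i k. \<tau> i = Some k \<longrightarrow> i dvd k)}"

lemma nearly_fullD:
  assumes "\<tau> \<in> nearly_full n"
  shows "dom \<tau> = {1..<n}" "inj_on \<tau> {1..<n}"
    and "\<And>i k. \<tau> i = Some k \<Longrightarrow> i dvd k \<and> i \<le> k \<and> 1 \<le> k \<and> k \<le> n \<and> 1 \<le> i \<and> i < n"
    and "\<And>i. \<tau> i = None \<longleftrightarrow> i \<notin> {1..<n}"
    and "\<And>i j k. \<tau> i = Some k \<Longrightarrow> \<tau> j = Some k \<Longrightarrow> i = j"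
proof -
  show dom: "dom \<tau> = {1..<n}" and inj: "inj_on \<tau> {1..<n}"
    using assms by (auto simp: nearly_full_def)
  show "i dvd k \<and> i \<le> k \<and> 1 \<le> k \<and> k \<le> n \<and> 1 \<le> i \<and> i < n" if "\<tau> i = Some k" for i k
  proof -
    have "i dvd k" "k \<in> {1..n}" "i \<in> {1..<n}"
      using assms that dom by (auto simp: nearly_full_def ran_def)
    then show ?thesis by (auto dest: dvd_imp_le)
  qed
  show "\<tau> i = None \<longleftrightarrow> i \<notin> {1..<n}" for i
    using dom by (metis domIff)
  show "i = j" if "\<tau> i = Some k" "\<tau> j = Some k" for i j k
    using inj that dom by (metis domI inj_onD)
qed

lemma finite_nearly_full: "finite (nearly_full n)"
proof (rule finite_subset)
  show "nearly_full n \<subseteq> {\<tau>. dom \<tau> = {1..<n} \<and> ran \<tau> \<subseteq> {1..n}}"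
    by (auto simp: nearly_full_def)
qed (simp add: finite_set_of_finite_maps)

definition id_below :: "nat \<Rightarrow> (nat \<rightharpoonup> nat)" where
  "id_below n = (\<lambda>i. if i \<in> {1..<n} then Some i else None)"

definition occupying :: "nat \<Rightarrow> (nat \<rightharpoonup> nat) set" where
  "occupying n = {\<tau> \<in> nearly_full n. n \<in> ran \<tau>}"

lemma finite_occupying: "finite (occupying n)"
  by (simp add: occupying_def finite_nearly_full)

lemma nearly_full_eq: "nearly_full n = insert (id_below n) (occupying n)"
proof (intro equalityI subsetI)
  fix \<tau> assume \<tau>: "\<tau> \<in> nearly_full n"
  note D = nearly_fullD[OF \<tau>]
  show "\<tau> \<in> insert (id_below n) (occupying n)"
  proof (cases "n \<in> ran \<tau>")
    case True
    then show ?thesis using \<tau> by (simp add: occupying_def)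
  next
    case False
    have Ivl: "{1..<n} = {1..n - 1}" by auto
    have "\<tau> i = Some i" if "i \<in> {1..<n}" for i
    proof (rule inj_increasing_eq_id)
      show "inj_on \<tau> {1..n - 1}" "i \<in> {1..n - 1}"
        using D(2) that by (simp_all only: Ivl)
    next
      fix i assume "i \<in> {1..n - 1}"
      then obtain k where "\<tau> i = Some k"
        using D(4)[of i] Ivl by auto
      moreover from this have "k \<noteq> n" using False by (auto simp: ran_def)
      ultimately show "\<exists>k. \<tau> i = Some k \<and> i \<le> k \<and> k \<le> n - 1"
        using D(3)[of i k] by auto
    qed
    then have "\<tau> = id_below n"
      using D(4) by (auto simp: id_below_def fun_eq_iff)
    then show ?thesis by simp
  qed
next
  fix \<tau> assume "\<tau> \<in> insert (id_below n) (occupying n)"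
  moreover have "id_below n \<in> nearly_full n"
    by (auto simp: nearly_full_def id_below_def dom_def ran_def inj_on_def split: if_splits)
  ultimately show "\<tau> \<in> nearly_full n" by (auto simp: occupying_def)
qed

lemma card_nearly_full: "card (nearly_full n) = 1 + card (occupying n)"
proof -
  have "id_below n \<notin> occupying n"
    by (auto simp: occupying_def ran_def id_below_def split: if_splits)
  then show ?thesis
    by (simp add: nearly_full_eq finite_occupying)
qed

section \<open>Almost full cinema mappings\<close>

lemma cinema_mapping_id: "cinema_mapping n (id_below (Suc n))"
proof -
  have dom: "dom (id_below (Suc n)) = {1..n}"
    by (auto simp: id_below_def dom_def split: if_splits)
  have "i \<in> {1..n}" if "i dvd j" "j \<in> {1..n}" for i j :: nat
    using that dvd_imp_le[of i j] by (cases "i = 0") auto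
  then show ?thesis
    unfolding cinema_mapping_def dom
    by (auto simp: ran_def inj_on_def id_below_def split: if_splits)
qed

text \<open>For a map that leaves ticket \<open>n\<close> without a seat, the exit rule concerns only the seat \<open>n\<close>, since
  \<open>n\<close> is its only multiple among the seats; hence \<open>occupying\<close> appears.\<close>

lemma almost_full_eq:
  assumes "n > 0"
  shows "{\<sigma>. almost_full n \<sigma>} = insert (id_below (Suc n)) (occupying n)"
proof (intro equalityI subsetI)
  fix \<sigma> assume "\<sigma> \<in> {\<sigma>. almost_full n \<sigma>}"
  then have c: "cinema_mapping n \<sigma>" and sub: "{1..n - 1} \<subseteq> dom \<sigma>"
    by (auto simp: almost_full_def)
  have dom: "dom \<sigma> \<subseteq> {1..n}" and ran: "ran \<sigma> \<subseteq> {1..n}" and inj: "inj_on \<sigma> (dom \<sigma>)"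
    and mult: "\<forall>i \<in> dom \<sigma>. i dvd the (\<sigma> i)"
    and exit: "\<forall>i \<in> {1..n} - dom \<sigma>. \<forall>m \<in> {1..n}. i dvd m \<longrightarrow> (\<exists>j < i. \<sigma> j = Some m)"
    using c unfolding cinema_mapping_def by - (elim conjE, assumption)+
  have dvd: "i dvd k" if "\<sigma> i = Some k" for i k
    using bspec[OF mult domI[of \<sigma> i k]] that by simp
  show "\<sigma> \<in> insert (id_below (Suc n)) (occupying n)"
  proof (cases "n \<in> dom \<sigma>")
    case True
    have "{1..n} = insert n {1..n - 1}" using assms by auto
    then have dom_eq: "dom \<sigma> = {1..n}" using dom sub True by auto
    have "\<sigma> i = Some i" if "i \<in> {1..n}" for i
    proof (rule inj_increasing_eq_id)
      show "inj_on \<sigma> {1..n}" "i \<in> {1..n}" using inj dom_eq that by simp_all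
    next
      fix i assume "i \<in> {1..n}"
      then obtain k where k: "\<sigma> i = Some k" using dom_eq by blast
      then have "k \<in> {1..n}" using ran by (auto simp: ran_def)
      then show "\<exists>k. \<sigma> i = Some k \<and> i \<le> k \<and> k \<le> n"
        using k dvd[OF k] by (auto dest: dvd_imp_le)
    qed
    moreover have "\<sigma> i = None" if "i \<notin> {1..n}" for i
      using that dom_eq by blast
    ultimately have "\<sigma> = id_below (Suc n)"
      by (auto simp: id_below_def fun_eq_iff)
    then show ?thesis by simp
  next
    case False
    have "{1..n} = insert n {1..<n}" "{1..n - 1} = {1..<n}" using assms by auto
    then have dom_eq: "dom \<sigma> = {1..<n}" using dom sub False by auto
    have "\<exists>j<n. \<sigma> j = Some n"
      using bspec[OF bspec[OF exit, of n], of n] False assms by simp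
    then have "n \<in> ran \<sigma>" by (auto simp: ran_def)
    then have "\<sigma> \<in> occupying n"
      using dom_eq ran inj dvd by (auto simp: occupying_def nearly_full_def)
    then show ?thesis by simp
  qed
next
  fix \<sigma> assume "\<sigma> \<in> insert (id_below (Suc n)) (occupying n)"
  moreover have "almost_full n (id_below (Suc n))"
    using cinema_mapping_id[of n] by (auto simp: almost_full_def id_below_def dom_def)
  moreover have "almost_full n \<sigma>" if occ: "\<sigma> \<in> occupying n"
  proof -
    have \<sigma>: "\<sigma> \<in> nearly_full n" and n: "n \<in> ran \<sigma>"
      using occ by (auto simp: occupying_def)
    note D = nearly_fullD[OF \<sigma>]
    have first: "i \<in> {1..<n}" if "i dvd j" "j \<in> {1..<n}" for i j
      using that dvd_imp_le[of i j] by (cases "i = 0") auto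
    have exit: "\<exists>j<i. \<sigma> j = Some m" if "i \<in> {1..n} - {1..<n}" "m \<in> {1..n}" "i dvd m" for i m
    proof -
      have "i = n" "m = n" using that by (auto dest: dvd_imp_le)
      then show ?thesis using n D(3) by (auto simp: ran_def)
    qed
    have "ran \<sigma> \<subseteq> {1..n}" using \<sigma> by (simp add: nearly_full_def)
    moreover have "i dvd the (\<sigma> i)" if "i \<in> {1..<n}" for i
      using that D(3,4)[of i] by (cases "\<sigma> i") auto
    ultimately have "cinema_mapping n \<sigma>"
      unfolding cinema_mapping_def D(1) using D(2) first exit by auto
    then show ?thesis using D(1) by (auto simp: almost_full_def)
  qed
  ultimately show "\<sigma> \<in> {\<sigma>. almost_full n \<sigma>}" by auto
qed

text \<open>The two families differ only in which identity they contain: on \<open>1, \<dots>, n\<close> for the almost full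
  mappings, on \<open>1, \<dots>, n - 1\<close> for the nearly full ones.\<close>

lemma psi_eq_card_nearly_full:
  assumes "n > 0"
  shows "psi n = card (nearly_full n)"
proof -
  have "id_below (Suc n) n \<noteq> None"
    using assms by (simp add: id_below_def)
  then have "id_below (Suc n) \<notin> occupying n"
    by (auto simp: occupying_def dest: nearly_fullD(4)[of _ n n])
  then show ?thesis
    by (simp add: psi_def almost_full_eq[OF assms] card_nearly_full finite_occupying)
qed

section \<open>Decomposition by the ticket on the last seat\<close>

text \<open>The only way to continue a nearly full map for \<open>d\<close> once ticket \<open>d\<close> has taken seat \<open>n\<close>.\<close>

definition extend :: "nat \<Rightarrow> nat \<Rightarrow> (nat \<rightharpoonup> nat) \<Rightarrow> (nat \<rightharpoonup> nat)" where
  "extend n d \<tau> =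
     (\<lambda>i. if i < d then \<tau> i else if i = d then Some n else if i < n then Some i else None)"

lemma extend_in_occupying:
  assumes d: "d dvd n" "d < n" "d > 0" and \<tau>: "\<tau> \<in> nearly_full d"
  shows "extend n d \<tau> \<in> occupying n"
proof -
  note D = nearly_fullD[OF \<tau>]
  have dom: "dom (extend n d \<tau>) = {1..<n}"
  proof (rule set_eqI)
    fix i show "i \<in> dom (extend n d \<tau>) \<longleftrightarrow> i \<in> {1..<n}"
      using D(4)[of i] d by (auto simp: extend_def dom_def)
  qed
  have props: "i dvd k \<and> k \<in> {1..n}" if "extend n d \<tau> i = Some k" for i k
    using that d D(3)[of i k] by (auto simp: extend_def split: if_splits)
  have "inj_on (extend n d \<tau>) {1..<n}"
  proof (rule inj_onI)
    fix i j assume "i \<in> {1..<n}" "j \<in> {1..<n}" and eq: "extend n d \<tau> i = extend n d \<tau> j"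
    then obtain k where k: "extend n d \<tau> i = Some k" "extend n d \<tau> j = Some k"
      using dom by (metis domD)
    then show "i = j"
      using d D(3)[of i k] D(3)[of j k] D(5)[of i k j]
      by (auto simp: extend_def split: if_splits)
  qed
  moreover have "extend n d \<tau> d = Some n" by (simp add: extend_def)
  ultimately show ?thesis
    using dom props by (auto simp: occupying_def nearly_full_def ran_def)
qed

text \<open>Conversely, let \<open>d\<close> be the ticket on seat \<open>n\<close>. The tickets strictly between \<open>d\<close> and \<open>n\<close> are
  forced onto their own seats; by injectivity the tickets below \<open>d\<close> then stay within \<open>1, \<dots>, d\<close>.\<close>

lemma occupying_imp_extend:
  assumes "\<sigma> \<in> occupying n"
  obtains d \<tau> where "d dvd n" "d < n" "\<tau> \<in> nearly_full d" "\<sigma> = extend n d \<tau>"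
proof -
  have \<sigma>: "\<sigma> \<in> nearly_full n" and "n \<in> ran \<sigma>"
    using assms by (auto simp: occupying_def)
  note D = nearly_fullD[OF \<sigma>]
  from \<open>n \<in> ran \<sigma>\<close> obtain d where dn: "\<sigma> d = Some n" by (auto simp: ran_def)
  have d: "d dvd n" "d < n" "1 \<le> d" using D(3)[OF dn] by auto
  have above: "\<sigma> i = Some i" if "d < i" "i < n" for i
  proof (rule inj_increasing_eq_id)
    show "inj_on \<sigma> {d + 1..n - 1}"
      by (rule inj_on_subset[OF D(2)]) auto
    show "i \<in> {d + 1..n - 1}" using that by auto
  next
    fix i assume i: "i \<in> {d + 1..n - 1}"
    then obtain k where k: "\<sigma> i = Some k" using D(4)[of i] by auto
    have "k \<noteq> n" using D(5)[OF k] dn i by auto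
    then show "\<exists>k. \<sigma> i = Some k \<and> i \<le> k \<and> k \<le> n - 1"
      using k D(3)[OF k] by auto
  qed
  define \<tau> where "\<tau> = \<sigma> |` {1..<d}"
  have \<tau>_iff: "\<tau> i = Some k \<longleftrightarrow> i < d \<and> \<sigma> i = Some k" for i k
    using D(3)[of i k] by (auto simp: \<tau>_def restrict_map_def)
  have le_d: "k \<le> d" if k: "\<sigma> i = Some k" and "i < d" for i k
  proof (rule ccontr)
    assume "\<not> k \<le> d"
    moreover have "k \<noteq> n" using D(5)[OF k, of d] dn \<open>i < d\<close> by auto
    ultimately have "\<sigma> k = Some k" using above[of k] D(3)[OF k] by simp
    then show False using D(5)[OF k, of k] \<open>i < d\<close> \<open>\<not> k \<le> d\<close> by simp
  qed
  have "ran \<tau> \<subseteq> {1..d}"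
  proof
    fix k assume "k \<in> ran \<tau>"
    then obtain i where "\<tau> i = Some k" by (auto simp: ran_def)
    then show "k \<in> {1..d}" using le_d[of i k] D(3)[of i k] by (simp add: \<tau>_iff)
  qed
  moreover have "dom \<tau> = {1..<d}"
    using D(1) d by (auto simp: \<tau>_def)
  moreover have "inj_on \<tau> {1..<d}"
    using inj_on_subset[OF D(2), of "{1..<d}"] d by (simp add: \<tau>_def inj_on_def)
  ultimately have "\<tau> \<in> nearly_full d"
    using D(3) by (simp add: nearly_full_def \<tau>_iff)
  moreover have "\<sigma> = extend n d \<tau>"
  proof
    fix i show "\<sigma> i = extend n d \<tau> i"
      using above[of i] dn D(4)[of i] by (auto simp: extend_def \<tau>_def restrict_map_def)
  qed
  ultimately show thesis using that d by blast
qed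

lemma occupying_eq:
  assumes "n > 0"
  shows "occupying n = (\<Union>d\<in>{d. d dvd n \<and> d \<noteq> n}. extend n d ` nearly_full d)"
proof (intro equalityI subsetI)
  fix \<sigma> assume "\<sigma> \<in> occupying n"
  then show "\<sigma> \<in> (\<Union>d\<in>{d. d dvd n \<and> d \<noteq> n}. extend n d ` nearly_full d)"
    by (rule occupying_imp_extend) auto
next
  fix \<sigma> assume "\<sigma> \<in> (\<Union>d\<in>{d. d dvd n \<and> d \<noteq> n}. extend n d ` nearly_full d)"
  then obtain d \<tau> where d: "d dvd n" "d \<noteq> n" and "\<tau> \<in> nearly_full d" "\<sigma> = extend n d \<tau>"
    by auto
  moreover have "d < n" "d > 0" using d assms by (auto dest: dvd_imp_le intro: Nat.gr0I)
  ultimately show "\<sigma> \<in> occupying n" using extend_in_occupying by blast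
qed

lemma inj_on_extend: "inj_on (extend n d) (nearly_full d)"
proof (rule inj_onI)
  fix \<tau> \<tau>' assume \<tau>: "\<tau> \<in> nearly_full d" "\<tau>' \<in> nearly_full d"
    and eq: "extend n d \<tau> = extend n d \<tau>'"
  show "\<tau> = \<tau>'"
  proof
    fix i show "\<tau> i = \<tau>' i"
    proof (cases "i < d")
      case True
      then show ?thesis using fun_cong[OF eq, of i] by (simp add: extend_def)
    next
      case False
      then have "\<tau> i = None" "\<tau>' i = None"
        using nearly_fullD(4)[OF \<tau>(1)] nearly_fullD(4)[OF \<tau>(2)] by auto
      then show ?thesis by simp
    qed
  qed
qed

lemma card_occupying:
  assumes "n > 0"
  shows "card (occupying n) = (\<Sum>d | d dvd n \<and> d \<noteq> n. card (nearly_full d))"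
proof -
  have disj: "extend n d ` nearly_full d \<inter> extend n e ` nearly_full e = {}"
    if d: "d dvd n" "d \<noteq> n" and e: "e dvd n" "e \<noteq> n" and "d \<noteq> e" for d e
  proof (rule ccontr)
    assume "extend n d ` nearly_full d \<inter> extend n e ` nearly_full e \<noteq> {}"
    then obtain \<tau> \<rho> where *: "\<tau> \<in> nearly_full d" "extend n d \<tau> = extend n e \<rho>" by auto
    have "d < n" "d > 0"
      using d assms by (auto dest: dvd_imp_le intro: Nat.gr0I)
    then have "extend n d \<tau> \<in> nearly_full n"
      using extend_in_occupying[OF d(1) _ _ *(1)] by (simp add: occupying_def)
    \<comment> \<open>Both \<open>d\<close> and \<open>e\<close> hold seat \<open>n\<close> in the common extension, which is injective.\<close>
    moreover have "extend n d \<tau> d = Some n" "extend n d \<tau> e = Some n"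
      by (simp add: extend_def, simp add: *(2), simp add: extend_def)
    ultimately show False using nearly_fullD(5) \<open>d \<noteq> e\<close> by blast
  qed
  have "finite {d. d dvd n \<and> d \<noteq> n}"
    using assms by simp
  then have "card (occupying n) =
      (\<Sum>d | d dvd n \<and> d \<noteq> n. card (extend n d ` nearly_full d))"
    unfolding occupying_eq[OF assms]
    by (intro card_UN_disjoint) (auto simp: finite_nearly_full dest: disj)
  then show ?thesis by (simp add: card_image[OF inj_on_extend])
qed

theorem theorem5p2:
  shows "psi 1 = 1 \<and> (\<forall>n > 0. psi n = 1 + (\<Sum>d | d dvd n \<and> d \<noteq> n. psi d))"
proof -
  have rec: "psi n = 1 + (\<Sum>d | d dvd n \<and> d \<noteq> n. psi d)" if "n > 0" for n
  proof -
    have "(\<Sum>d | d dvd n \<and> d \<noteq> n. card (nearly_full d)) = (\<Sum>d | d dvd n \<and> d \<noteq> n. psi d)"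
      using that by (intro sum.cong) (auto simp: psi_eq_card_nearly_full intro: Nat.gr0I)
    then show ?thesis
      by (simp add: psi_eq_card_nearly_full[OF that] card_nearly_full card_occupying[OF that])
  qed
  moreover have "{d :: nat. d dvd 1 \<and> d \<noteq> 1} = {}" by auto
  ultimately have "psi 1 = 1" by (metis add_0_right less_one sum.empty)
  with rec show ?thesis by blast
qed

end
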